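(* Let $k \geq 3$ and $n \geq k+2$. Suppose that $\mathcal{F}$ is a family of $k$-element subsets of $[n]=\{1,2,\ldots,n\}$ such that every $(k,2)$-cluster of $\mathcal{F}$ is intersecting, i.e., for any $A_1,\ldots,A_k\in\mathcal{F}$, $|A_1\cup\cdots\cup A_k|\leq 2k$ implies $A_1\cap\cdots\cap A_k\neq\emptyset$. Then $\mathcal{F}$ contains no $(k-1)$-dimensional simplices.
   Context: A family of $k$-subsets $A_1,\ldots,A_d$ of $[n]$ is called a $(d,c)$-cluster (with $c<d$) if $|A_1\cup\cdots\cup A_d|\leq ck$; a cluster is intersecting if $A_1\cap\cdots\cap A_d\neq\emptyset$. A $d$-dimensional simplex is a family of $d+1$ sets $A_1,\ldots,A_{d+1}$ such that every $d$ of them have a nonempty intersection, but $A_1\cap\cdots\cap A_{d+1}=\emptyset$. *)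

theory Defs
  imports "HOL-Library.Ramsey"
begin

text \<open>Families are sets of sets, so the members \<open>A\<^sub>1, \<dots>, A\<^sub>d\<close> of a cluster or of a simplex are pairwise
  distinct. For simplices this is automatic. For clusters it makes ``every cluster is intersecting''
  a weaker condition than its analogue for tuples with repetitions.\<close>

definition is_cluster :: "nat \<Rightarrow> nat \<Rightarrow> nat \<Rightarrow> nat \<Rightarrow> nat set set \<Rightarrow> bool" where
  "is_cluster n k d c \<A> \<longleftrightarrow>
     c < d \<and> \<A> \<subseteq> nsets {1..n} k \<and> card \<A> = d \<and> card (\<Union>\<A>) \<le> c * k"

definition is_intersecting :: "'a set set \<Rightarrow> bool" where
  "is_intersecting \<A> \<longleftrightarrow> \<Inter>\<A> \<noteq> {}"

text \<open>A \<open>d\<close>-dimensional simplex has \<open>d + 1\<close> members.\<close>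

definition is_simplex :: "nat \<Rightarrow> 'a set set \<Rightarrow> bool" where
  "is_simplex d \<S> \<longleftrightarrow>
     card \<S> = d + 1 \<and> (\<forall>\<T> \<subseteq> \<S>. card \<T> = d \<longrightarrow> \<Inter>\<T> \<noteq> {}) \<and> \<Inter>\<S> = {}"

end

theory Submission
  imports Defs
begin

text \<open>Picking a vertex \<open>f A\<close> common to all members but \<open>A\<close> gives \<open>d + 1\<close> distinct vertices, of which
  every member contains exactly \<open>d\<close>. For \<open>d = k - 1\<close> each member has thus only one further element,
  so a \<open>(k - 1)\<close>-dimensional simplex of \<open>k\<close>-sets is a non-intersecting \<open>(k, 2)\<close>-cluster.\<close>

lemma card_Union_simplex_le:
  assumes simplex: "is_simplex d \<S>" and size: "\<And>A. A \<in> \<S> \<Longrightarrow> finite A \<and> card A = k"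
  shows "card (\<Union>\<S>) \<le> (d + 1) + (d + 1) * (k - d)"
proof -
  have card: "card \<S> = d + 1" and empty: "\<Inter>\<S> = {}"
    using simplex by (auto simp: is_simplex_def)
  have fin: "finite \<S>"
    using card by (simp add: card_ge_0_finite)
  have "\<exists>x. x \<in> \<Inter>(\<S> - {A})" if "A \<in> \<S>" for A
  proof -
    have "card (\<S> - {A}) = d"
      using that card fin by simp
    then have "\<Inter>(\<S> - {A}) \<noteq> {}"
      using simplex by (simp add: is_simplex_def)
    then show ?thesis by blast
  qed
  then obtain f where f: "\<And>A. A \<in> \<S> \<Longrightarrow> f A \<in> \<Inter>(\<S> - {A})"
    by metis
  have mem: "f A \<in> B" if "A \<in> \<S>" "B \<in> \<S>" "A \<noteq> B" for A B
    using f that by blast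
  \<comment> \<open>If \<open>f A\<close> lay in \<open>A\<close> as well, it would belong to every
    member, against the empty intersection.\<close>
  have notin: "f A \<notin> A" if "A \<in> \<S>" for A
    using mem[OF that] empty by blast
  \<comment> \<open>For \<open>A\<close> and \<open>B\<close> distinct, \<open>f B\<close> lies in
    \<open>A\<close> but \<open>f A\<close> does not.\<close>
  have inj: "inj_on f \<S>"
    using mem notin by (metis inj_onI)
  \<comment> \<open>The \<open>d\<close> vertices of the other members all lie in \<open>A\<close>
    and use up \<open>d\<close> of its \<open>k\<close> elements.\<close>
  have extra: "card (A - f ` \<S>) \<le> k - d" if A: "A \<in> \<S>" for A
  proof -
    have "f ` (\<S> - {A}) \<subseteq> A"
      using mem A by blast
    moreover have "card (f ` (\<S> - {A})) = d"
      using card_image[OF inj_on_subset[OF inj]] A card fin by simp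
    ultimately have "card (A - f ` (\<S> - {A})) = k - d"
      using fin size[OF A] by (simp add: card_Diff_subset)
    moreover have "card (A - f ` \<S>) \<le> card (A - f ` (\<S> - {A}))"
      using size[OF A] by (intro card_mono) auto
    ultimately show ?thesis by simp
  qed
  \<comment> \<open>Shared vertices are counted once for the whole family; only the leftovers are
    summed member by member.\<close>
  have "card (\<Union>\<S>) \<le> card (f ` \<S> \<union> (\<Union>A\<in>\<S>. A - f ` \<S>))"
    using fin size by (intro card_mono) auto
  also have "\<dots> \<le> card (f ` \<S>) + card (\<Union>A\<in>\<S>. A - f ` \<S>)"
    by (rule card_Un_le)
  also have "card (\<Union>A\<in>\<S>. A - f ` \<S>) \<le> (\<Sum>A\<in>\<S>. card (A - f ` \<S>))"
    by (rule card_UN_le[OF fin])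
  also have "\<dots> \<le> (d + 1) * (k - d)"
    using sum_bounded_above[of \<S>, OF extra] card by simp
  finally show ?thesis
    using card_image[OF inj] card by simp
qed

theorem theorem2p1:
  fixes n k :: nat and \<F> :: "nat set set"
  assumes "k \<ge> 3" and "n \<ge> k + 2"
    and "\<F> \<subseteq> nsets {1..n} k"
    and "\<And>\<A>. \<A> \<subseteq> \<F> \<Longrightarrow> is_cluster n k k 2 \<A> \<Longrightarrow> is_intersecting \<A>"
  shows "\<not> (\<exists>\<S> \<subseteq> \<F>. is_simplex (k - 1) \<S>)"
proof
  assume "\<exists>\<S> \<subseteq> \<F>. is_simplex (k - 1) \<S>"
  then obtain \<S> where sub: "\<S> \<subseteq> \<F>" and simplex: "is_simplex (k - 1) \<S>"
    by blast
  have "finite A \<and> card A = k" if "A \<in> \<S>" for A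
    using that sub assms(3) by (auto simp: nsets_def)
  \<comment> \<open>With \<open>d = k - 1\<close> the bound reads \<open>k + k * 1\<close>.\<close>
  then have "card (\<Union>\<S>) \<le> 2 * k"
    using card_Union_simplex_le[OF simplex, of k] assms(1) by simp
  moreover have "card \<S> = k" and "\<Inter>\<S> = {}"
    using simplex assms(1) by (auto simp: is_simplex_def)
  \<comment> \<open>The requirement \<open>c < d\<close> becomes \<open>2 < k\<close>, which is
    \<open>k \<ge> 3\<close>.\<close>
  ultimately have "is_cluster n k k 2 \<S>"
    using sub assms(1,3) by (auto simp: is_cluster_def)
  then have "is_intersecting \<S>"
    using assms(4) sub by blast
  then show False
    using \<open>\<Inter>\<S> = {}\<close> by (simp add: is_intersecting_def)
qed

end
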